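(* Let $\gamma = (\gamma_n)_{n=0}^\infty$ (with $\gamma_0 = 1$) be the moment sequence of a completely hyperexpansive weighted shift with $c := \gamma_1 - \gamma_0 > 0$, and let $\mu$ be the Berger measure of the associated subnormal weighted shift $W$ whose moment sequence is (after normalization) $\Delta\gamma$; that is, $\mu$ is the Borel probability measure such that $$\gamma_{n+1} - \gamma_n = c\int x^n \, d\mu(x) \quad (n = 0,1,2,\ldots).$$ Assume that $W$ is contractive (so that $\mu$ is supported in $[0,1]$). Then $\gamma$ admits a Berger-type charge representation if and only if $$\int_0^1 \frac{1}{1-x}\, d\mu(x) < \infty .$$
   Context: For a weight sequence $\alpha = (\alpha_n)_{n\ge 0}$, the weighted shift $W_\alpha$ acts on $\ell^2$ with standard basis $\{e_j\}_{j\ge0}$ by $W_\alpha e_j = \alpha_j e_{j+1}$; its moments are $\gamma_0 = 1$ and $\gamma_j = \prod_{i=0}^{j-1}\alpha_i^2$ for $j \ge 1$. For a sequence $s$, set $(\Delta s)_n = s_{n+1} - s_n$ and $\nabla = -\Delta$. A sequence $s$ is completely monotone if $(\nabla^k s)_n \ge 0$ for all $n,k \ge 0$, and completely alternating if $\Delta s$ is completely monotone. A weighted shift is completely hyperexpansive (CHE) if its moment sequence is completely alternating. A weighted shift is subnormal iff its moment sequence $(\gamma_n)$ has a Berger measure: a probability measure compactly supported in $\mathbb{R}_+ = [0,\infty)$ with $\gamma_n = \int t^n\,d\mu(t)$ for all $n\ge 0$. A Berger-type charge representation of $\gamma$ is a finite signed Borel measure $\eta$ with compact support in $\mathbb{R}_+$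 such that $\gamma_n = \int t^n\, d\eta(t)$ for all $n \ge 0$. Conventions: $0^0 = 1$, and $\frac{1}{1-x} = +\infty$ at $x = 1$. *)

theory Defs
  imports "HOL-Analysis.Analysis" "HOL-Probability.Probability"
begin

definition ell2 :: "(nat \<Rightarrow> complex) set" where
  "ell2 = {x. summable (\<lambda>n. (norm (x n))\<^sup>2)}"

definition ell2_norm :: "(nat \<Rightarrow> complex) \<Rightarrow> real" where
  "ell2_norm x = sqrt (\<Sum>n. (norm (x n))\<^sup>2)"

(* Zero weights are admitted: a subnormal shift with Berger measure the unit mass at 0
   has moments 1, 0, 0, ... *)
definition weight_sequence :: "(nat \<Rightarrow> real) \<Rightarrow> bool" where
  "weight_sequence \<alpha> \<longleftrightarrow> (\<forall>n. 0 \<le> \<alpha> n) \<and> bounded (range \<alpha>)"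

definition weighted_shift :: "(nat \<Rightarrow> real) \<Rightarrow> (nat \<Rightarrow> complex) \<Rightarrow> (nat \<Rightarrow> complex)" where
  "weighted_shift \<alpha> x = (\<lambda>n. case n of 0 \<Rightarrow> 0 | Suc j \<Rightarrow> complex_of_real (\<alpha> j) * x j)"

lemma weighted_shift_basis:
  "weighted_shift \<alpha> (\<lambda>i. if i = j then 1 else 0) =
     (\<lambda>i. complex_of_real (\<alpha> j) * (if i = Suc j then 1 else 0))"
  by (auto simp: weighted_shift_def fun_eq_iff split: nat.split)

definition contractive :: "((nat \<Rightarrow> complex) \<Rightarrow> (nat \<Rightarrow> complex)) \<Rightarrow> bool" where
  "contractive T \<longleftrightarrow> (\<forall>x\<in>ell2. T x \<in> ell2 \<and> ell2_norm (T x) \<le> ell2_norm x)"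

definition moments :: "(nat \<Rightarrow> real) \<Rightarrow> nat \<Rightarrow> real" where
  "moments \<alpha> n = (\<Prod>i<n. (\<alpha> i)\<^sup>2)"

definition fdiff :: "(nat \<Rightarrow> real) \<Rightarrow> nat \<Rightarrow> real" where
  "fdiff s n = s (Suc n) - s n"

definition nabla :: "(nat \<Rightarrow> real) \<Rightarrow> nat \<Rightarrow> real" where
  "nabla s n = - fdiff s n"

definition completely_monotone :: "(nat \<Rightarrow> real) \<Rightarrow> bool" where
  "completely_monotone s \<longleftrightarrow> (\<forall>n k. (nabla ^^ k) s n \<ge> 0)"

definition completely_alternating :: "(nat \<Rightarrow> real) \<Rightarrow> bool" where
  "completely_alternating s \<longleftrightarrow> completely_monotone (fdiff s)"

definition completely_hyperexpansive :: "(nat \<Rightarrow> real) \<Rightarrow> bool" where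
  "completely_hyperexpansive \<alpha> \<longleftrightarrow> completely_alternating (moments \<alpha>)"

definition berger_measure :: "(nat \<Rightarrow> real) \<Rightarrow> real measure \<Rightarrow> bool" where
  "berger_measure s \<mu> \<longleftrightarrow>
     prob_space \<mu> \<and> sets \<mu> = sets borel \<and>
     (\<exists>K. compact K \<and> K \<subseteq> {0..} \<and> emeasure \<mu> (- K) = 0) \<and>
     (\<forall>n. s n = (\<integral>t. t ^ n \<partial>\<mu>))"

(* Values of a signed measure outside the Borel sets are irrelevant; finiteness is
   enforced by the real range. *)
definition finite_signed_borel_measure :: "(real set \<Rightarrow> real) \<Rightarrow> bool" where
  "finite_signed_borel_measure \<eta> \<longleftrightarrow>
     \<eta> {} = 0 \<and>
     (\<forall>A :: nat \<Rightarrow> real set. range A \<subseteq> sets borel \<longrightarrow> disjoint_family A \<longrightarrow>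
        (\<lambda>i. \<eta> (A i)) sums \<eta> (\<Union>i. A i))"

(* Jordan decomposition: the positive variation of A is the supremum of the values on Borel
   subsets of A. Since the empty set is among them, truncating negative values by ennreal
   does not change the supremum. *)
definition pos_variation :: "(real set \<Rightarrow> real) \<Rightarrow> real measure" where
  "pos_variation \<eta> =
     measure_of UNIV (sets borel) (\<lambda>A. SUP B\<in>{B \<in> sets borel. B \<subseteq> A}. ennreal (\<eta> B))"

definition neg_variation :: "(real set \<Rightarrow> real) \<Rightarrow> real measure" where
  "neg_variation \<eta> = pos_variation (\<lambda>A. - \<eta> A)"

definition signed_integral :: "(real set \<Rightarrow> real) \<Rightarrow> (real \<Rightarrow> real) \<Rightarrow> real" where
  "signed_integral \<eta> f = (\<integral>t. f t \<partial>pos_variation \<eta>) - (\<integral>t. f t \<partial>neg_variation \<eta>)"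

(* For a signed measure, being carried by K means vanishing on every Borel subset of the
   complement, not merely on the complement itself. *)
definition berger_charge :: "(nat \<Rightarrow> real) \<Rightarrow> (real set \<Rightarrow> real) \<Rightarrow> bool" where
  "berger_charge s \<eta> \<longleftrightarrow>
     finite_signed_borel_measure \<eta> \<and>
     (\<exists>K. compact K \<and> K \<subseteq> {0..} \<and> (\<forall>A\<in>sets borel. A \<inter> K = {} \<longrightarrow> \<eta> A = 0)) \<and>
     (\<forall>n. s n = signed_integral \<eta> (\<lambda>t. t ^ n))"

end

theory Submission
  imports Defs
begin

text \<open>
  Both conditions say that the measure \<open>c / (1 - x) d\<mu>(x)\<close> is finite. If it is, summing the
  geometric series in \<open>\<gamma> n = 1 + c * (\<Sum>k<n. \<integral>x ^ k d\<mu>)\<close> exhibits \<open>\<gamma>\<close> as the moments of a multiple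
  of the point mass at 1 minus this measure, and these two parts are mutually singular. Conversely,
  a charge \<open>\<eta>\<close> with moments \<open>\<gamma>\<close> satisfies \<open>c * \<integral>f d\<mu> = \<integral>(t - 1) * f t d\<eta>(t)\<close> for polynomials, hence
  for continuous \<open>f\<close>. For \<open>f t = 1 / (\<bar>1 - t\<bar> + 1 / k)\<close> the right-hand side is at most the total
  variation of \<open>\<eta>\<close>, and Fatou's lemma bounds \<open>c * \<integral>1 / \<bar>1 - x\<bar> d\<mu>(x)\<close>.
\<close>

section \<open>The variations of a finite signed measure\<close>

lemma signed_measure_empty: "finite_signed_borel_measure \<eta> \<Longrightarrow> \<eta> {} = 0"
  by (simp add: finite_signed_borel_measure_def)

lemma signed_measure_sums:
  fixes A :: "nat \<Rightarrow> real set"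
  assumes "finite_signed_borel_measure \<eta>" "range A \<subseteq> sets borel" "disjoint_family A"
  shows "(\<lambda>i. \<eta> (A i)) sums \<eta> (\<Union>i. A i)"
  using assms by (auto simp: finite_signed_borel_measure_def)

lemma signed_measure_uminus:
  assumes "finite_signed_borel_measure \<eta>"
  shows "finite_signed_borel_measure (\<lambda>A. - \<eta> A)"
  using assms unfolding finite_signed_borel_measure_def by (auto intro: sums_minus)

lemma signed_measure_Un:
  assumes \<eta>: "finite_signed_borel_measure \<eta>"
    and A: "A \<in> sets borel" and B: "B \<in> sets borel" and disj: "A \<inter> B = {}"
  shows "\<eta> (A \<union> B) = \<eta> A + \<eta> B"
proof -
  have "(\<lambda>n. \<eta> (binaryset A B n)) sums (\<eta> A + \<eta> B)"
    by (rule binaryset_sums) (rule signed_measure_empty[OF \<eta>])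
  moreover have "(\<lambda>n. \<eta> (binaryset A B n)) sums \<eta> (\<Union>n. binaryset A B n)"
  proof (rule signed_measure_sums[OF \<eta>])
    show "range (binaryset A B) \<subseteq> sets borel"
      using A B by (auto simp: range_binaryset_eq)
    show "disjoint_family (binaryset A B)"
      using disj by (auto simp: disjoint_family_on_def binaryset_def)
  qed
  ultimately show ?thesis
    by (auto simp: UN_binaryset_eq dest: sums_unique2)
qed

lemma signed_measure_split:
  assumes "finite_signed_borel_measure \<eta>" "A \<in> sets borel" "B \<in> sets borel"
  shows "\<eta> B = \<eta> (B \<inter> A) + \<eta> (B - A)"
proof -
  have "\<eta> ((B \<inter> A) \<union> (B - A)) = \<eta> (B \<inter> A) + \<eta> (B - A)"
    by (rule signed_measure_Un) (use assms in auto)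
  moreover have "(B \<inter> A) \<union> (B - A) = B" by auto
  ultimately show ?thesis by simp
qed

text \<open>
  If \<open>\<eta>\<close> were unbounded on the Borel subsets of \<open>E\<close>, it would be unbounded on one half of a
  splitting of \<open>E\<close> whose two halves both have charge at least 1 in absolute value. Iterating
  gives disjoint sets whose charges do not tend to 0.
\<close>
lemma signed_measure_bounded:
  assumes \<eta>: "finite_signed_borel_measure \<eta>"
  shows "bounded (\<eta> ` sets borel)"
proof (rule ccontr)
  \<comment> \<open>\<open>U E\<close> says that the charge is unbounded on the Borel subsets of
    \<open>E\<close>.\<close>
  define U where "U E = (\<nexists>a. \<forall>B. B \<in> sets borel \<longrightarrow> B \<subseteq> E \<longrightarrow> \<bar>\<eta> B\<bar> \<le> a)" for E
  assume "\<not> bounded (\<eta> ` sets borel)"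
  then have U0: "U UNIV" by (auto simp: U_def bounded_iff)
  have step: "\<exists>F. (F \<in> sets borel \<and> U F) \<and> (F \<subseteq> E \<and> 1 \<le> \<bar>\<eta> (E - F)\<bar>)"
    if E: "E \<in> sets borel" "U E" for E
  proof -
    \<comment> \<open>The margin \<bar>\<eta> E\<bar> + 1 makes both halves large: the charge of
      \<open>E - A\<close> is the charge of \<open>E\<close> minus that of \<open>A\<close>, so it
      also has absolute value at least 1.\<close>
    obtain A where A: "A \<in> sets borel" "A \<subseteq> E" "\<bar>\<eta> E\<bar> + 1 < \<bar>\<eta> A\<bar>"
      using E(2) unfolding U_def by (meson not_le)
    have "\<eta> E = \<eta> A + \<eta> (E - A)"
      using signed_measure_split[OF \<eta> A(1) E(1)] A(2) by (simp add: Int_absorb1)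
    then have big: "1 \<le> \<bar>\<eta> (E - A)\<bar>" "1 \<le> \<bar>\<eta> A\<bar>" using A(3) by linarith+
    have "U A \<or> U (E - A)"
    proof (rule ccontr)
      assume "\<not> (U A \<or> U (E - A))"
      then have bd: "\<not> U A" "\<not> U (E - A)" by simp_all
      obtain a where a: "\<And>B. B \<in> sets borel \<Longrightarrow> B \<subseteq> A \<Longrightarrow> \<bar>\<eta> B\<bar> \<le> a"
        using bd(1) unfolding U_def by blast
      obtain b where b: "\<And>B. B \<in> sets borel \<Longrightarrow> B \<subseteq> E - A \<Longrightarrow> \<bar>\<eta> B\<bar> \<le> b"
        using bd(2) unfolding U_def by blast
      have "\<bar>\<eta> B\<bar> \<le> a + b" if B: "B \<in> sets borel" "B \<subseteq> E" for B
      proof -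
        have "\<bar>\<eta> (B \<inter> A)\<bar> \<le> a" by (rule a) (use A B in auto)
        moreover have "\<bar>\<eta> (B - A)\<bar> \<le> b" by (rule b) (use A B in auto)
        ultimately show ?thesis using signed_measure_split[OF \<eta> A(1) B(1)] by linarith
      qed
      with E(2) show False unfolding U_def by blast
    qed
    then show ?thesis
    proof
      assume "U A"
      then show ?thesis using A big by blast
    next
      assume "U (E - A)"
      moreover have "E - (E - A) = A" using A(2) by blast
      ultimately show ?thesis using A(1) E(1) big by (intro exI[of _ "E - A"]) auto
    qed
  qed
  obtain E where E: "\<And>n. E n \<in> sets borel \<and> U (E n)"
    and sub: "\<And>n. E (Suc n) \<subseteq> E n \<and> 1 \<le> \<bar>\<eta> (E n - E (Suc n))\<bar>"
    using dependent_nat_choice[of "\<lambda>_ E. E \<in> sets borel \<and> U E"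
        "\<lambda>_ E F. F \<subseteq> E \<and> 1 \<le> \<bar>\<eta> (E - F)\<bar>"] step U0 sets.top[of borel]
    by (metis space_borel)
  define A where "A n = E n - E (Suc n)" for n
  have dec: "E n \<subseteq> E m" if "m \<le> n" for m n
    using that by (rule lift_Suc_antimono_le[rotated]) (use sub in auto)
  \<comment> \<open>For m < n the set \<open>A n\<close> lies in \<open>E n\<close>, hence in
    \<open>E (Suc m)\<close>, which was removed from \<open>A m\<close>.\<close>
  have "A m \<inter> A n = {}" if "m < n" for m n
    using dec[of "Suc m" n] that by (auto simp: A_def)
  then have "disjoint_family A"
    unfolding disjoint_family_on_def by (metis Int_commute linorder_neqE_nat)
  moreover have "range A \<subseteq> sets borel" using E by (auto simp: A_def)
  ultimately have "(\<lambda>i. \<eta> (A i)) sums \<eta> (\<Union>i. A i)"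
    by (intro signed_measure_sums[OF \<eta>])
  then have "(\<lambda>i. \<eta> (A i)) \<longlonglongrightarrow> 0" by (intro summable_LIMSEQ_zero) (rule sums_summable)
  then have "eventually (\<lambda>i. dist (\<eta> (A i)) 0 < 1) sequentially" by (rule tendstoD) simp
  then obtain i where "\<bar>\<eta> (A i)\<bar> < 1" by (auto simp: eventually_sequentially)
  with sub[of i] show False by (simp add: A_def)
qed

section \<open>The positive variation as a finite measure\<close>

lemma space_pos_variation [simp]: "space (pos_variation \<eta>) = UNIV"
  by (simp add: pos_variation_def space_measure_of_conv)

lemma sets_pos_variation [simp, measurable_cong]: "sets (pos_variation \<eta>) = sets borel"
  using sets.sigma_sets_eq[of "borel :: real measure"]
  by (simp add: pos_variation_def sets_measure_of_conv)

text \<open>\<open>ennreal\<close> sends negative numbers to 0, so summands of mixed sign can cancel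
  on the left but not on the right.\<close>

lemma ennreal_sum_le: "ennreal (sum f A) \<le> (\<Sum>i\<in>A. ennreal (f i))"
proof -
  have "ennreal (sum f A) \<le> ennreal (\<Sum>i\<in>A. max 0 (f i))"
    by (intro ennreal_leI sum_mono) auto
  also have "\<dots> = (\<Sum>i\<in>A. ennreal (max 0 (f i)))"
    by (rule sum_ennreal[symmetric]) simp
  also have "(\<lambda>i. ennreal (max 0 (f i))) = (\<lambda>i. ennreal (f i))"
    by (auto simp: max_def ennreal_neg)
  finally show ?thesis .
qed

text \<open>\<open>measure_of\<close> takes the prescribed values only if these form a measure, so
  countable additivity of the supremum has to be proved. Superadditivity on disjoint sets and
  monotonicity give one inequality for a countable union; cutting a Borel subset of the union into
  its pieces and using the countable additivity of the charge gives the other.\<close>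

lemma emeasure_pos_variation:
  assumes \<eta>: "finite_signed_borel_measure \<eta>" and A: "A \<in> sets borel"
  shows "emeasure (pos_variation \<eta>) A = (SUP B\<in>{B \<in> sets borel. B \<subseteq> A}. ennreal (\<eta> B))"
proof -
  define V where "V A = (SUP B\<in>{B \<in> sets borel. B \<subseteq> A}. ennreal (\<eta> B))" for A
  have upper: "ennreal (\<eta> B) \<le> V A" if "B \<in> sets borel" "B \<subseteq> A" for A B
    unfolding V_def by (rule SUP_upper) (use that in auto)
  have mono: "V A \<le> V B" if "A \<subseteq> B" for A B
    unfolding V_def by (rule SUP_subset_mono) (use that in auto)
  have super: "V A + V B \<le> V (A \<union> B)" if "A \<inter> B = {}" for A B
  proof -
    have "ennreal (\<eta> A') + ennreal (\<eta> B') \<le> V (A \<union> B)"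
      if A': "A' \<in> sets borel" "A' \<subseteq> A" and B': "B' \<in> sets borel" "B' \<subseteq> B" for A' B'
    proof -
      have "\<eta> (A' \<union> B') = \<eta> A' + \<eta> B'"
        by (rule signed_measure_Un[OF \<eta>]) (use A' B' \<open>A \<inter> B = {}\<close> in auto)
      moreover have "ennreal (\<eta> (A' \<union> B')) \<le> V (A \<union> B)"
        "ennreal (\<eta> A') \<le> V (A \<union> B)" "ennreal (\<eta> B') \<le> V (A \<union> B)"
        by (rule upper; use A' B' in auto)+
      \<comment> \<open>If one of the two charges is negative, its \<open>ennreal\<close> is 0 and
        the bound for the other one alone suffices.\<close>
      ultimately show ?thesis
        by (cases "\<eta> A' \<ge> 0"; cases "\<eta> B' \<ge> 0") (auto simp: ennreal_neg)
    qed
    \<comment> \<open>The two suprema are taken one after the other, first over \<open>A'\<close>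
      and then over \<open>B'\<close>.\<close>
    then have "V A + ennreal (\<eta> B') \<le> V (A \<union> B)" if "B' \<in> sets borel" "B' \<subseteq> B" for B'
      unfolding V_def[of A] by (subst ennreal_SUP_add_left[symmetric]) (use that in \<open>auto intro!: SUP_least\<close>)
    then have "V A + (SUP B'\<in>{B' \<in> sets borel. B' \<subseteq> B}. ennreal (\<eta> B')) \<le> V (A \<union> B)"
      by (subst ennreal_SUP_add_right) (auto intro!: SUP_least)
    then show ?thesis by (simp add: V_def[of B])
  qed
  have fin: "(\<Sum>i<n. V (F i)) \<le> V (\<Union>i<n. F i)" if "disjoint_family F" for F :: "nat \<Rightarrow> real set" and n
  proof (induction n)
    case (Suc n)
    have "(\<Union>i<n. F i) \<inter> F n = {}"
      using that unfolding disjoint_family_on_def by (fastforce dest: less_imp_neq)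
    from super[OF this] Suc show ?case
      by (auto simp: lessThan_Suc Un_commute add.commute intro: order_trans[OF add_left_mono])
  qed simp
  have "countably_additive (sets borel) V"
  proof (rule countably_additiveI)
    fix F :: "nat \<Rightarrow> real set"
    assume F: "range F \<subseteq> sets borel" "disjoint_family F"
    show "(\<Sum>i. V (F i)) = V (\<Union>i. F i)"
    proof (rule antisym)
      show "(\<Sum>i. V (F i)) \<le> V (\<Union>i. F i)"
        by (rule suminf_le_const) (auto intro: order_trans[OF fin[OF F(2)] mono])
      show "V (\<Union>i. F i) \<le> (\<Sum>i. V (F i))"
        unfolding V_def[of "\<Union>i. F i"]
      proof (rule SUP_least, safe)
        fix B :: "real set" assume B: "B \<in> sets borel" "B \<subseteq> (\<Union>i. F i)"
        have "(\<lambda>i. \<eta> (B \<inter> F i)) sums \<eta> (\<Union>i. B \<inter> F i)"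
        proof (rule signed_measure_sums[OF \<eta>])
          show "disjoint_family (\<lambda>i. B \<inter> F i)" using F(2) by (rule disjoint_family_on_bisimulation) auto
        qed (use B F in auto)
        moreover have "(\<Union>i. B \<inter> F i) = B" using B by auto
        \<comment> \<open>Partial sums are compared before passing to the limit, since the real
          series may have terms of both signs.\<close>
        ultimately have "(\<lambda>n. ennreal (\<Sum>i<n. \<eta> (B \<inter> F i))) \<longlonglongrightarrow> ennreal (\<eta> B)"
          by (simp add: sums_def tendsto_ennrealI)
        then show "ennreal (\<eta> B) \<le> (\<Sum>i. V (F i))"
        proof (rule LIMSEQ_le_const2, intro exI allI impI)
          fix n
          have "ennreal (\<Sum>i<n. \<eta> (B \<inter> F i)) \<le> (\<Sum>i<n. ennreal (\<eta> (B \<inter> F i)))"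
            by (rule ennreal_sum_le)
          also have "\<dots> \<le> (\<Sum>i<n. V (F i))"
            by (intro sum_mono upper) (use B F in auto)
          also have "\<dots> \<le> (\<Sum>i. V (F i))" by (rule sum_le_suminf) auto
          finally show "ennreal (\<Sum>i<n. \<eta> (B \<inter> F i)) \<le> (\<Sum>i. V (F i))" .
        qed
      qed
    qed
  qed
  moreover have "positive (sets borel) V"
  proof -
    have "{B \<in> sets borel. B \<subseteq> {}} = {{} :: real set}" by auto
    then show ?thesis by (simp add: positive_def V_def signed_measure_empty[OF \<eta>])
  qed
  moreover have "sigma_algebra UNIV (sets (borel :: real measure))"
    using sets.sigma_algebra_axioms[of "borel :: real measure"] by simp
  ultimately have "emeasure (measure_of UNIV (sets borel) V) A = V A"
    by (intro emeasure_measure_of_sigma A)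
  then show ?thesis unfolding pos_variation_def V_def[abs_def] .
qed

lemma finite_measure_pos_variation:
  assumes \<eta>: "finite_signed_borel_measure \<eta>"
  shows "finite_measure (pos_variation \<eta>)"
proof
  obtain a where "\<And>B. B \<in> sets borel \<Longrightarrow> \<bar>\<eta> B\<bar> \<le> a"
    using signed_measure_bounded[OF \<eta>] unfolding bounded_iff by auto
  then have "(SUP B\<in>{B \<in> sets borel. B \<subseteq> UNIV}. ennreal (\<eta> B)) \<le> ennreal a"
    by (intro SUP_least ennreal_leI) (auto simp: abs_le_iff)
  then have "emeasure (pos_variation \<eta>) UNIV \<le> ennreal a"
    by (subst emeasure_pos_variation[OF \<eta>]) auto
  then show "emeasure (pos_variation \<eta>) (space (pos_variation \<eta>)) \<noteq> \<infinity>"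
    by (auto simp: top_unique)
qed

text \<open>The supremum defining the variation of \<open>- K\<close> runs over Borel sets that miss
  \<open>K\<close>, and the charge vanishes on each of them.\<close>

lemma AE_pos_variation:
  assumes \<eta>: "finite_signed_borel_measure \<eta>" and K: "K \<in> sets borel"
    and null: "\<And>A. A \<in> sets borel \<Longrightarrow> A \<inter> K = {} \<Longrightarrow> \<eta> A = 0"
  shows "AE t in pos_variation \<eta>. t \<in> K"
proof (rule AE_I)
  have "(SUP B\<in>{B \<in> sets borel. B \<subseteq> - K}. ennreal (\<eta> B)) \<le> 0"
  proof (rule SUP_least, safe)
    fix B assume "B \<in> sets borel" "B \<subseteq> - K"
    then have "\<eta> B = 0" by (intro null) auto
    then show "ennreal (\<eta> B) \<le> 0" by simp
  qed
  then show "emeasure (pos_variation \<eta>) (- K) = 0"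
    using emeasure_pos_variation[OF \<eta>, of "- K"] K by auto
qed (use K in auto)

section \<open>Differences of two finite measures\<close>

lemma signed_measure_diff:
  assumes P: "finite_measure P" "sets P = sets borel" and N: "finite_measure N" "sets N = sets borel"
  shows "finite_signed_borel_measure (\<lambda>A. measure P A - measure N A)"
  unfolding finite_signed_borel_measure_def
  using finite_measure.finite_measure_UNION[OF P(1)] finite_measure.finite_measure_UNION[OF N(1)] P(2) N(2)
  by (auto intro!: sums_diff)

text \<open>The supremum defining the positive variation of \<open>A\<close> is attained at \<open>A \<inter> D\<close>.\<close>
lemma pos_variation_diff:
  assumes P: "finite_measure P" "sets P = sets borel" and N: "finite_measure N" "sets N = sets borel"
    and D: "D \<in> sets borel" "emeasure P (- D) = 0" "emeasure N D = 0"
  shows "pos_variation (\<lambda>A. measure P A - measure N A) = P"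
proof (rule measure_eqI)
  let ?\<eta> = "\<lambda>A. measure P A - measure N A"
  interpret P: finite_measure P by fact
  interpret N: finite_measure N by fact
  fix A assume "A \<in> sets (pos_variation ?\<eta>)"
  then have A: "A \<in> sets borel" by simp
  have "(SUP B\<in>{B \<in> sets borel. B \<subseteq> A}. ennreal (?\<eta> B)) = emeasure P A"
  proof (rule antisym)
    show "(SUP B\<in>{B \<in> sets borel. B \<subseteq> A}. ennreal (?\<eta> B)) \<le> emeasure P A"
    proof (rule SUP_least, safe)
      fix B assume "B \<in> sets borel" "B \<subseteq> A"
      then have "measure P B \<le> measure P A" using A P(2) by (intro P.finite_measure_mono) auto
      then show "ennreal (?\<eta> B) \<le> emeasure P A"
        unfolding P.emeasure_eq_measure by (intro ennreal_leI) (simp add: diff_le_eq add_increasing2)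
    qed
    \<comment> \<open>Intersecting with \<open>D\<close> costs no \<open>P\<close>-mass and leaves
      no \<open>N\<close>-mass, so \<open>A \<inter> D\<close> has charge exactly
      \<open>P A\<close>.\<close>
    have "A - D \<in> null_sets P"
      by (rule null_sets_subset[of "- D"]) (use A D P(2) in auto)
    then have "emeasure P (A \<inter> D) = emeasure P A"
      using emeasure_Diff_null_set[of "A - D" P A] A P(2) by (simp add: Diff_Diff_Int)
    moreover have "emeasure N (A \<inter> D) = 0"
      using emeasure_mono[of "A \<inter> D" D N] D N(2) by simp
    ultimately have "emeasure P A = ennreal (?\<eta> (A \<inter> D))"
      by (simp add: P.emeasure_eq_measure N.emeasure_eq_measure)
    also have "\<dots> \<le> (SUP B\<in>{B \<in> sets borel. B \<subseteq> A}. ennreal (?\<eta> B))"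
      by (rule SUP_upper) (use A D in auto)
    finally show "emeasure P A \<le> (SUP B\<in>{B \<in> sets borel. B \<subseteq> A}. ennreal (?\<eta> B))" .
  qed
  then show "emeasure (pos_variation ?\<eta>) A = emeasure P A"
    using emeasure_pos_variation[OF signed_measure_diff[OF P N] A] by simp
qed (use P in simp)

text \<open>The negative variation is the positive variation of \<open>N\<close> minus
  \<open>P\<close>, so the preceding lemma identifies it as \<open>N\<close> once the roles are
  exchanged and \<open>D\<close> is replaced by its complement.\<close>

lemma signed_integral_diff:
  assumes P: "finite_measure P" "sets P = sets borel" and N: "finite_measure N" "sets N = sets borel"
    and D: "D \<in> sets borel" "emeasure P (- D) = 0" "emeasure N D = 0"
  shows "signed_integral (\<lambda>A. measure P A - measure N A) f = (\<integral>t. f t \<partial>P) - (\<integral>t. f t \<partial>N)"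
  using pos_variation_diff[OF P N D] pos_variation_diff[OF N P, of "- D"] D
  by (simp add: signed_integral_def neg_variation_def)

section \<open>Moments and continuous functions\<close>

lemma integrable_continuous_compact_support:
  fixes f :: "real \<Rightarrow> real"
  assumes "finite_measure M" "sets M = sets borel" "compact K" "AE t in M. t \<in> K"
    and f: "continuous_on UNIV f"
  shows "integrable M f"
proof -
  have "compact (f ` K)"
    using f \<open>compact K\<close> by (intro compact_continuous_image) (auto intro: continuous_on_subset)
  then obtain B where "\<And>t. t \<in> K \<Longrightarrow> \<bar>f t\<bar> \<le> B"
    using compact_imp_bounded by (fastforce simp: bounded_iff)
  then have "AE t in M. norm (f t) \<le> B" using \<open>AE t in M. t \<in> K\<close> by auto
  moreover have "f \<in> borel_measurable M"
    using borel_measurable_continuous_onI[OF f] assms(2) by (simp cong: measurable_cong_sets)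
  ultimately show ?thesis by (rule finite_measure.integrable_const_bound[OF assms(1)])
qed

text \<open>Dominated convergence: on \<open>K\<close> each \<open>p k\<close> differs from
  \<open>f\<close> by at most 1. The factor \<open>w\<close> will be 1 for one measure and t - 1 for
  the two variations.\<close>

lemma integral_tendsto_uniform_approx:
  fixes f :: "real \<Rightarrow> real"
  assumes M: "finite_measure M" "sets M = sets borel" "compact K" "AE t in M. t \<in> K"
    and f: "continuous_on UNIV f" and w: "continuous_on UNIV w"
    and p: "\<And>k. continuous_on UNIV (p k)"
    and approx: "\<And>k t. t \<in> K \<Longrightarrow> \<bar>f t - p k t\<bar> < 1 / real (Suc k)"
  shows "(\<lambda>k. \<integral>t. w t * p k t \<partial>M) \<longlonglongrightarrow> (\<integral>t. w t * f t \<partial>M)"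
proof (rule integral_dominated_convergence[where w = "\<lambda>t. \<bar>w t\<bar> * (\<bar>f t\<bar> + 1)"])
  note int = integrable_continuous_compact_support[OF M]
  show "integrable M (\<lambda>t. \<bar>w t\<bar> * (\<bar>f t\<bar> + 1))"
    by (intro int continuous_intros f w)
  show "(\<lambda>t. w t * f t) \<in> borel_measurable M" "\<And>k. (\<lambda>t. w t * p k t) \<in> borel_measurable M"
    by (intro borel_measurable_integrable int continuous_intros f w p)+
  show "AE t in M. (\<lambda>k. w t * p k t) \<longlonglongrightarrow> w t * f t"
    using M(4)
  proof eventually_elim
    fix t assume "t \<in> K"
    have "(\<lambda>k. p k t - f t) \<longlonglongrightarrow> 0"
    proof (rule Lim_null_comparison)
      show "\<forall>\<^sub>F k in sequentially. norm (p k t - f t) \<le> 1 / real (Suc k)"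
        using less_imp_le[OF approx[OF \<open>t \<in> K\<close>]] by (auto simp: abs_minus_commute)
      show "(\<lambda>k. 1 / real (Suc k)) \<longlonglongrightarrow> 0" by (rule LIMSEQ_Suc[OF lim_1_over_n])
    qed
    then show "(\<lambda>k. w t * p k t) \<longlonglongrightarrow> w t * f t"
      by (intro tendsto_mult tendsto_const) (simp add: LIM_zero_iff)
  qed
  show "AE t in M. norm (w t * p k t) \<le> \<bar>w t\<bar> * (\<bar>f t\<bar> + 1)" for k
    using M(4)
  proof eventually_elim
    fix t assume "t \<in> K"
    have "1 / real (Suc k) \<le> 1" by simp
    then have "\<bar>p k t\<bar> \<le> \<bar>f t\<bar> + 1" using approx[OF \<open>t \<in> K\<close>, of k] by linarith
    then show "norm (w t * p k t) \<le> \<bar>w t\<bar> * (\<bar>f t\<bar> + 1)"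
      by (simp add: abs_mult mult_left_mono)
  qed
qed

text \<open>Both sides are linear in \<open>f\<close>, so the moment identities give the equality
  for polynomials, and Weierstrass approximation on \<open>K\<close> carries it over to continuous
  functions. The same polynomials must approximate for all three measures, hence the common
  \<open>K\<close>.\<close>

lemma moment_identity_continuous:
  fixes f :: "real \<Rightarrow> real"
  assumes M: "finite_measure M" "sets M = sets borel" "AE t in M. t \<in> K"
    and P: "finite_measure P" "sets P = sets borel" "AE t in P. t \<in> K"
    and N: "finite_measure N" "sets N = sets borel" "AE t in N. t \<in> K"
    and K: "compact K" and w: "continuous_on UNIV w"
    and mom: "\<And>n. c * (\<integral>t. t ^ n \<partial>M) = (\<integral>t. w t * t ^ n \<partial>P) - (\<integral>t. w t * t ^ n \<partial>N)"
    and f: "continuous_on UNIV f"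
  shows "c * (\<integral>t. f t \<partial>M) = (\<integral>t. w t * f t \<partial>P) - (\<integral>t. w t * f t \<partial>N)"
proof -
  have "\<exists>p. real_polynomial_function p \<and> (\<forall>t\<in>K. \<bar>f t - p t\<bar> < 1 / real (Suc k))" for k
    using Stone_Weierstrass_real_polynomial_function[OF K continuous_on_subset[OF f subset_UNIV], of "1 / real (Suc k)"]
    by (metis of_nat_0_less_iff zero_less_Suc zero_less_divide_1_iff)
  then obtain p where p: "\<And>k. real_polynomial_function (p k)"
    and approx: "\<And>k t. t \<in> K \<Longrightarrow> \<bar>f t - p k t\<bar> < 1 / real (Suc k)"
    by metis
  have pc: "continuous_on UNIV (p k)" for k
    using p by (simp add: continuous_on_polymonial_function real_polynomial_function_eq)
  \<comment> \<open>The factor 1 puts the left-hand integral into the weighted form shared by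
    \<open>lin\<close> and \<open>lim\<close>.\<close>
  have eq: "c * (\<integral>t. 1 * p k t \<partial>M) = (\<integral>t. w t * p k t \<partial>P) - (\<integral>t. w t * p k t \<partial>N)" for k
  proof -
    obtain a n where pk: "p k = (\<lambda>t. \<Sum>i\<le>n. a i * t ^ i)"
      using p[of k] by (auto simp: real_polynomial_function_iff_sum)
    have lin: "(\<integral>t. v t * p k t \<partial>Q) = (\<Sum>i\<le>n. a i * (\<integral>t. v t * t ^ i \<partial>Q))"
      if "finite_measure Q" "sets Q = sets borel" "AE t in Q. t \<in> K" "continuous_on UNIV v" for Q v
    proof -
      have "integrable Q (\<lambda>t. v t * t ^ i)" for i
        by (rule integrable_continuous_compact_support) (use that K in \<open>simp_all add: continuous_on_mult continuous_on_power continuous_on_id\<close>)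
      then have "(\<integral>t. (\<Sum>i\<le>n. a i * (v t * t ^ i)) \<partial>Q) = (\<Sum>i\<le>n. a i * (\<integral>t. v t * t ^ i \<partial>Q))"
        by simp
      then show ?thesis by (simp add: pk sum_distrib_left mult.left_commute)
    qed
    have "c * (\<integral>t. 1 * p k t \<partial>M) = (\<Sum>i\<le>n. a i * (c * (\<integral>t. t ^ i \<partial>M)))"
      by (subst lin[OF M]) (auto simp: sum_distrib_left mult.left_commute)
    also have "\<dots> = (\<integral>t. w t * p k t \<partial>P) - (\<integral>t. w t * p k t \<partial>N)"
      by (simp add: lin[OF P w] lin[OF N w] mom sum_subtractf right_diff_distrib)
    finally show ?thesis .
  qed
  note lim = integral_tendsto_uniform_approx[where f = f and p = p, OF _ _ K _ f _ pc approx]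
  have "(\<lambda>k. c * (\<integral>t. 1 * p k t \<partial>M)) \<longlonglongrightarrow> c * (\<integral>t. 1 * f t \<partial>M)"
    by (intro tendsto_intros lim M) auto
  moreover have "(\<lambda>k. (\<integral>t. w t * p k t \<partial>P) - (\<integral>t. w t * p k t \<partial>N))
      \<longlonglongrightarrow> (\<integral>t. w t * f t \<partial>P) - (\<integral>t. w t * f t \<partial>N)"
    by (intro tendsto_diff lim P N w) auto
  ultimately show ?thesis unfolding eq by (auto dest: LIMSEQ_unique)
qed

text \<open>At \<open>t = 1\<close> the integrand is \<open>\<infinity>\<close>, so the conclusion includes that \<open>M\<close> has no atom there.\<close>
lemma nn_integral_reciprocal_finite:
  fixes M :: "real measure"
  assumes M: "finite_measure M" "sets M = sets borel" "AE t in M. t \<in> K"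
    and P: "finite_measure P" "sets P = sets borel" "AE t in P. t \<in> K"
    and N: "finite_measure N" "sets N = sets borel" "AE t in N. t \<in> K"
    and K: "compact K" and c: "c > 0"
    and mom: "\<And>n. c * (\<integral>t. t ^ n \<partial>M) = (\<integral>t. (t - 1) * t ^ n \<partial>P) - (\<integral>t. (t - 1) * t ^ n \<partial>N)"
  shows "(\<integral>\<^sup>+t. 1 / ennreal \<bar>1 - t\<bar> \<partial>M) < \<infinity>"
proof -
  define B where "B = measure P (space P) + measure N (space N)"
  \<comment> \<open>The summand 1 / (k + 1) keeps the denominator away from 0, so \<open>f k\<close>
    is continuous even at 1.\<close>
  define f where "f k t = 1 / (\<bar>1 - t\<bar> + 1 / real (Suc k))" for k and t :: real
  have pos: "0 < \<bar>1 - t\<bar> + 1 / real (Suc k)" for k and t :: real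
    by (rule add_nonneg_pos) auto
  have fc: "continuous_on UNIV (f k)" for k
    unfolding f_def using pos by (intro continuous_intros) (metis less_irrefl)
  have f0: "0 \<le> f k t" for k t using pos[of t k] by (simp add: f_def)
  have bound: "\<bar>\<integral>t. (t - 1) * f k t \<partial>Q\<bar> \<le> measure Q (space Q)"
    if Q: "finite_measure Q" "sets Q = sets borel" "AE t in Q. t \<in> K" for Q k
  proof -
    interpret Q: finite_measure Q by fact
    have int: "integrable Q (\<lambda>t. (t - 1) * f k t)"
      by (intro integrable_continuous_compact_support[OF Q(1,2) K Q(3)] continuous_intros fc)
    \<comment> \<open>The weight t - 1 cancels the singularity, so the bound is uniform in
      \<open>k\<close>.\<close>
    have "\<bar>(t - 1) * f k t\<bar> \<le> 1" for t
      using pos[of t k] by (simp add: f_def abs_mult abs_divide divide_le_eq abs_minus_commute)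
    then have "(\<integral>t. \<bar>(t - 1) * f k t\<bar> \<partial>Q) \<le> (\<integral>t. 1 \<partial>Q)"
      by (intro integral_mono int integrable_abs) auto
    then show ?thesis by (intro order_trans[OF integral_abs_bound]) simp
  qed
  have nn: "(\<integral>\<^sup>+t. ennreal (f k t) \<partial>M) \<le> ennreal (B / c)" for k
  proof -
    have "c * (\<integral>t. f k t \<partial>M) = (\<integral>t. (t - 1) * f k t \<partial>P) - (\<integral>t. (t - 1) * f k t \<partial>N)"
      by (rule moment_identity_continuous[OF M P N K _ mom fc]) (intro continuous_intros)
    also have "\<dots> \<le> B"
      using bound[OF P, of k] bound[OF N, of k] unfolding B_def by linarith
    finally have "(\<integral>t. f k t \<partial>M) \<le> B / c" using c by (simp add: field_simps)
    moreover have "integrable M (f k)"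
      by (rule integrable_continuous_compact_support[OF M(1,2) K M(3) fc])
    ultimately show ?thesis by (simp add: nn_integral_eq_integral f0 ennreal_leI)
  qed
  have lim: "(\<lambda>k. ennreal (f k t)) \<longlonglongrightarrow> 1 / ennreal \<bar>1 - t\<bar>" for t
  proof -
    have "(\<lambda>k. \<bar>1 - t\<bar> + 1 / real (Suc k)) \<longlonglongrightarrow> \<bar>1 - t\<bar> + 0"
      by (intro tendsto_intros LIMSEQ_Suc[OF lim_1_over_n])
    then have "(\<lambda>k. ennreal (\<bar>1 - t\<bar> + 1 / real (Suc k))) \<longlonglongrightarrow> ennreal \<bar>1 - t\<bar>"
      by (intro tendsto_ennrealI) simp
    \<comment> \<open>Inversion is continuous on \<open>ennreal\<close> including at 0, so the case
      t = 1, with limit infinity, needs no separate treatment.\<close>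
    then have "(\<lambda>k. inverse (ennreal (\<bar>1 - t\<bar> + 1 / real (Suc k)))) \<longlonglongrightarrow> inverse (ennreal \<bar>1 - t\<bar>)"
      by (rule continuous_on_tendsto_compose[OF continuous_on_inverse_ennreal[OF continuous_on_id[of UNIV]]]) auto
    moreover have "inverse (ennreal (\<bar>1 - t\<bar> + 1 / real (Suc k))) = ennreal (f k t)" for k
      by (simp only: inverse_ennreal[OF pos] f_def inverse_eq_divide)
    ultimately show ?thesis by (simp add: divide_ennreal_def)
  qed
  have meas: "(\<lambda>t. ennreal (f k t)) \<in> borel_measurable M" for k
    using borel_measurable_continuous_onI[OF fc[of k]] M(2) by (simp cong: measurable_cong_sets)
  \<comment> \<open>Fatou's lemma transfers the uniform bound to the pointwise limit.\<close>
  have "(\<integral>\<^sup>+t. 1 / ennreal \<bar>1 - t\<bar> \<partial>M) = (\<integral>\<^sup>+t. liminf (\<lambda>k. ennreal (f k t)) \<partial>M)"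
    using lim by (intro nn_integral_cong) (metis lim_imp_Liminf sequentially_bot)
  also have "\<dots> \<le> liminf (\<lambda>k. \<integral>\<^sup>+t. ennreal (f k t) \<partial>M)"
    by (rule nn_integral_liminf) (rule meas)
  also have "\<dots> \<le> liminf (\<lambda>k. ennreal (B / c))"
    by (intro Liminf_mono always_eventually allI nn)
  also have "\<dots> < \<infinity>" by (simp add: Liminf_const)
  finally show ?thesis .
qed

section \<open>Contractive shifts and their Berger measures\<close>

text \<open>The shift maps the unit basis vector \<open>e j\<close> to a vector of norm
  \<bar>\<beta> j\<bar>.\<close>

lemma contractive_weight_le_1:
  assumes "weight_sequence \<beta>" "contractive (weighted_shift \<beta>)"
  shows "\<beta> j \<le> 1"
proof -
  define e :: "nat \<Rightarrow> nat \<Rightarrow> complex" where "e j = (\<lambda>i. if i = j then 1 else 0)" for j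
  have sq: "(\<lambda>n. (norm (a * e j n))\<^sup>2) sums (norm a)\<^sup>2" for a :: complex and j
  proof -
    have "(\<lambda>n. if n = j then (norm a)\<^sup>2 else 0) sums (norm a)\<^sup>2" by (rule sums_single)
    moreover have "(\<lambda>n. if n = j then (norm a)\<^sup>2 else 0) = (\<lambda>n. (norm (a * e j n))\<^sup>2)"
      by (auto simp: e_def)
    ultimately show ?thesis by simp
  qed
  have norm: "ell2_norm (\<lambda>n. a * e j n) = norm a" for a j
    unfolding ell2_norm_def sums_unique[OF sq[of a j], symmetric] by simp
  have "e j \<in> ell2" using sums_summable[OF sq[of 1 j]] by (simp add: ell2_def)
  then have "ell2_norm (weighted_shift \<beta> (e j)) \<le> ell2_norm (e j)"
    using assms(2) by (auto simp: contractive_def)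
  moreover have "weighted_shift \<beta> (e j) = (\<lambda>n. complex_of_real (\<beta> j) * e (Suc j) n)"
    using weighted_shift_basis[of \<beta> j] by (simp add: e_def)
  ultimately have "\<bar>\<beta> j\<bar> \<le> 1" using norm[of "complex_of_real (\<beta> j)" "Suc j"] norm[of 1 j] by simp
  then show ?thesis by simp
qed

text \<open>Positive mass on [a, \<infinity>) with a > 1 would make the n-th moment at least
  \<open>a ^ n\<close> times that mass, which is unbounded in \<open>n\<close>.\<close>

lemma bounded_moments_support:
  fixes M :: "real measure"
  assumes M: "finite_measure M" "sets M = sets borel" "AE t in M. t \<in> K" "compact K" "K \<subseteq> {0..}"
    and bound: "\<And>n. (\<integral>t. t ^ n \<partial>M) \<le> b"
  shows "AE t in M. t \<in> {0..1}"
proof -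
  interpret M: finite_measure M by fact
  have meas [measurable]: "{t. a \<le> t} \<in> sets M" for a :: real using M(2) by simp
  have null: "measure M {t. a \<le> t} = 0" if a: "1 < a" for a
  proof (rule ccontr)
    assume "measure M {t. a \<le> t} \<noteq> 0"
    then have pos: "0 < measure M {t. a \<le> t}" by (simp add: zero_less_measure_iff)
    obtain n where n: "b / measure M {t. a \<le> t} < a ^ n" using real_arch_pow[OF a] by blast
    have "a ^ n * measure M {t. a \<le> t} = (\<integral>t. a ^ n * indicator {t. a \<le> t} t \<partial>M)"
      using sets_eq_imp_space_eq[OF M(2)] by simp
    also have "\<dots> \<le> (\<integral>t. t ^ n \<partial>M)"
    proof (rule integral_mono_AE)
      show "integrable M (\<lambda>t. a ^ n * indicator {t. a \<le> t} t)"
        by (intro integrable_mult_right) (simp add: M.emeasure_eq_measure)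
      show "integrable M (\<lambda>t. t ^ n)"
        by (intro integrable_continuous_compact_support[OF M(1,2,4,3)] continuous_intros)
      show "AE t in M. a ^ n * indicator {t. a \<le> t} t \<le> t ^ n"
        using M(3)
      proof eventually_elim
        fix t assume "t \<in> K"
        then have "0 \<le> t" using M(5) by auto
        then show "a ^ n * indicator {t. a \<le> t} t \<le> t ^ n"
          using a by (auto simp: indicator_def intro: power_mono)
      qed
    qed
    also have "\<dots> \<le> b" by (rule bound)
    finally show False using n pos by (simp add: field_simps)
  qed
  \<comment> \<open>The half-line t > 1 is the countable union of the null sets t \<ge> 1 + 1 / (k +
    1).\<close>
  have "AE t in M. \<forall>k. \<not> 1 + 1 / real (Suc k) \<le> t"
  proof (subst AE_all_countable, intro allI)
    fix k
    have "{t. 1 + 1 / real (Suc k) \<le> t} \<in> null_sets M"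
      using null[of "1 + 1 / real (Suc k)"] by (simp add: null_sets_def M.emeasure_eq_measure M(2))
    then show "AE t in M. \<not> 1 + 1 / real (Suc k) \<le> t" by (auto dest: AE_not_in)
  qed
  with M(3) show ?thesis
  proof eventually_elim
    fix t assume t: "t \<in> K" "\<forall>k. \<not> 1 + 1 / real (Suc k) \<le> t"
    have "t \<le> 1"
    proof (rule ccontr)
      assume "\<not> t \<le> 1"
      then obtain k where "inverse (real (Suc k)) < t - 1"
        using reals_Archimedean[of "t - 1"] by auto
      then show False using t(2)[rule_format, of k] by (simp add: inverse_eq_divide)
    qed
    with t(1) M(5) show "t \<in> {0..1}" by auto
  qed
qed

section \<open>The two directions of the equivalence\<close>

lemma berger_charge_imp_finite:
  fixes \<mu> :: "real measure"
  assumes \<mu>: "finite_measure \<mu>" "sets \<mu> = sets borel" "AE t in \<mu>. t \<in> {0..1}"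
    and c: "c > 0" and mom: "\<And>n. \<gamma> (Suc n) - \<gamma> n = c * (\<integral>t. t ^ n \<partial>\<mu>)"
    and charge: "berger_charge \<gamma> \<eta>"
  shows "(\<integral>\<^sup>+x\<in>{0..1}. 1 / ennreal (1 - x) \<partial>\<mu>) < \<infinity>"
proof -
  let ?P = "pos_variation \<eta>" and ?N = "neg_variation \<eta>"
  obtain K where \<eta>: "finite_signed_borel_measure \<eta>" and K: "compact K"
    and null: "\<And>A. A \<in> sets borel \<Longrightarrow> A \<inter> K = {} \<Longrightarrow> \<eta> A = 0"
    and \<gamma>: "\<And>n. \<gamma> n = signed_integral \<eta> (\<lambda>t. t ^ n)"
    using charge unfolding berger_charge_def by auto
  have Kb: "K \<in> sets borel" using K by (simp add: borel_compact)
  \<comment> \<open>The carrier \<open>K\<close> of the charge need not contain the support of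
    \<open>\<mu>\<close>; the union carries all three measures.\<close>
  let ?K = "K \<union> {0..1}"
  have K': "compact ?K" using K by (intro compact_Un) auto
  have P: "finite_measure ?P" "sets ?P = sets borel" "AE t in ?P. t \<in> ?K"
    using finite_measure_pos_variation[OF \<eta>] AE_pos_variation[OF \<eta> Kb null] by auto
  have N: "finite_measure ?N" "sets ?N = sets borel" "AE t in ?N. t \<in> ?K"
    using finite_measure_pos_variation[OF signed_measure_uminus[OF \<eta>]]
      AE_pos_variation[OF signed_measure_uminus[OF \<eta>] Kb] null
    unfolding neg_variation_def by auto
  have \<mu>K: "AE t in \<mu>. t \<in> ?K" using \<mu>(3) by auto
  \<comment> \<open>Multiplying by t - 1 turns moments into their differences, which links the
    charge to \<open>\<mu>\<close>.\<close>
  have diff: "(\<integral>t. (t - 1) * t ^ n \<partial>Q) = (\<integral>t. t ^ Suc n \<partial>Q) - (\<integral>t. t ^ n \<partial>Q)"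
    if Q: "finite_measure Q" "sets Q = sets borel" "AE t in Q. t \<in> ?K" for Q n
  proof -
    have int: "integrable Q (\<lambda>t. t ^ n)" for n
      by (intro integrable_continuous_compact_support[OF Q(1,2) K' Q(3)] continuous_intros)
    have "(\<integral>t. t ^ Suc n - t ^ n \<partial>Q) = (\<integral>t. t ^ Suc n \<partial>Q) - (\<integral>t. t ^ n \<partial>Q)"
      by (rule Bochner_Integration.integral_diff[OF int int])
    then show ?thesis by (simp add: algebra_simps)
  qed
  have "(\<integral>\<^sup>+t. 1 / ennreal \<bar>1 - t\<bar> \<partial>\<mu>) < \<infinity>"
  proof (rule nn_integral_reciprocal_finite[OF \<mu>(1,2) \<mu>K P N K' c])
    fix n
    show "c * (\<integral>t. t ^ n \<partial>\<mu>) = (\<integral>t. (t - 1) * t ^ n \<partial>?P) - (\<integral>t. (t - 1) * t ^ n \<partial>?N)"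
      using mom[of n] \<gamma>[of n] \<gamma>[of "Suc n"]
      unfolding diff[OF P] diff[OF N] signed_integral_def by linarith
  qed
  moreover have "(\<integral>\<^sup>+x\<in>{0..1}. 1 / ennreal (1 - x) \<partial>\<mu>) \<le> (\<integral>\<^sup>+t. 1 / ennreal \<bar>1 - t\<bar> \<partial>\<mu>)"
    by (intro nn_integral_mono) (auto simp: indicator_def)
  ultimately show ?thesis by (rule le_less_trans[rotated])
qed

lemma finite_imp_berger_charge:
  fixes \<mu> :: "real measure"
  assumes \<mu>: "finite_measure \<mu>" "sets \<mu> = sets borel" "AE t in \<mu>. t \<in> {0..1}"
    and c: "c > 0" and \<gamma>0: "\<gamma> 0 \<ge> 0"
    and mom: "\<And>n. \<gamma> (Suc n) - \<gamma> n = c * (\<integral>t. t ^ n \<partial>\<mu>)"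
    and fin: "(\<integral>\<^sup>+x\<in>{0..1}. 1 / ennreal (1 - x) \<partial>\<mu>) < \<infinity>"
  shows "\<exists>\<eta>. berger_charge \<gamma> \<eta>"
proof -
  interpret \<mu>: finite_measure \<mu> by fact
  note [measurable_cong] = \<mu>(2)
  \<comment> \<open>The integrand is infinite at 1, so finiteness of the integral rules out an atom
    of \<open>\<mu>\<close> there.\<close>
  have "AE x in \<mu>. 1 / ennreal (1 - x) * indicator {0..1} x \<noteq> \<infinity>"
    by (rule nn_integral_noteq_infinite) (use fin in auto)
  with \<mu>(3) have AE1: "AE x in \<mu>. 0 \<le> x \<and> x < 1"
    by eventually_elim (auto simp: indicator_def divide_ennreal_def less_le)
  \<comment> \<open>A real-valued, everywhere nonnegative version of 1 / (1 - x); it agrees with it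
    almost everywhere.\<close>
  define g :: "real \<Rightarrow> real" where "g x = (if 0 \<le> x \<and> x < 1 then 1 / (1 - x) else 0)" for x
  have g_meas [measurable]: "g \<in> borel_measurable borel" unfolding g_def by measurable
  have g0: "0 \<le> g x" for x by (simp add: g_def)
  have g_int: "integrable \<mu> g"
  proof (rule integrableI_nonneg)
    have "(\<integral>\<^sup>+x. ennreal (g x) \<partial>\<mu>) \<le> (\<integral>\<^sup>+x\<in>{0..1}. 1 / ennreal (1 - x) \<partial>\<mu>)"
    proof (intro nn_integral_mono)
      fix x
      show "ennreal (g x) \<le> 1 / ennreal (1 - x) * indicator {0..1} x"
        using divide_ennreal[of 1 "1 - x"] by (auto simp: g_def indicator_def)
    qed
    then show "(\<integral>\<^sup>+x. ennreal (g x) \<partial>\<mu>) < \<infinity>" using fin by (rule le_less_trans)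
  qed (use g0 in auto)
  \<comment> \<open>This is the limit of \<open>\<gamma> n\<close>, and hence the mass to be placed
    at 1: the moments of \<open>N\<close>, which lives on [0, 1), tend to 0.\<close>
  define m where "m = \<gamma> 0 + c * (\<integral>x. g x \<partial>\<mu>)"
  have m0: "0 \<le> m" using c \<gamma>0 g0 by (simp add: m_def)
  define P where "P = density (return borel (1::real)) (\<lambda>_. ennreal m)"
  define N where "N = density \<mu> (\<lambda>x. ennreal (c * g x))"
  have sets [simp]: "sets P = sets borel" "sets N = sets borel" by (simp_all add: P_def N_def \<mu>(2))
  have P_emeasure: "emeasure P A = ennreal m * indicator A 1" if "A \<in> sets borel" for A
    using that by (simp add: P_def emeasure_density nn_integral_return)
  have P: "finite_measure P"
    using P_emeasure[of UNIV] sets_eq_imp_space_eq[OF sets(1)] by (intro finite_measureI) simp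
  have N: "finite_measure N"
  proof (rule finite_measureI)
    have "emeasure N (space N) = (\<integral>\<^sup>+x. ennreal (c * g x) \<partial>\<mu>)"
      by (simp add: N_def emeasure_density cong: nn_integral_cong)
    also have "\<dots> = ennreal (\<integral>x. c * g x \<partial>\<mu>)"
      by (rule nn_integral_eq_integral) (use g_int g0 c in auto)
    finally show "emeasure N (space N) \<noteq> \<infinity>" by simp
  qed
  have N_null: "emeasure N A = 0" if "A \<in> sets borel" "A \<inter> {0..<1} = {}" for A
  proof -
    have "emeasure N A = (\<integral>\<^sup>+x. ennreal (c * g x) * indicator A x \<partial>\<mu>)"
      using that by (simp add: N_def emeasure_density \<mu>(2))
    also have "\<dots> = (\<integral>\<^sup>+x. 0 \<partial>\<mu>)"
      by (intro nn_integral_cong) (use that in \<open>auto simp: g_def indicator_def\<close>)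
    finally show ?thesis by simp
  qed
  define \<eta> where "\<eta> A = measure P A - measure N A" for A
  have \<eta>: "finite_signed_borel_measure \<eta>"
    unfolding \<eta>_def by (rule signed_measure_diff) (use P N in auto)
  moreover have "\<forall>A\<in>sets borel. A \<inter> {0..1} = {} \<longrightarrow> \<eta> A = 0"
  proof safe
    fix A :: "real set" assume A: "A \<in> sets borel" "A \<inter> {0..1} = {}"
    then have "1 \<notin> A" by auto
    then have "emeasure P A = 0" using P_emeasure[OF A(1)] by simp
    moreover have "emeasure N A = 0" by (rule N_null) (use A in auto)
    ultimately show "\<eta> A = 0" by (simp add: \<eta>_def measure_def)
  qed
  moreover have "\<gamma> n = signed_integral \<eta> (\<lambda>t. t ^ n)" for n
  proof -
    have int: "integrable \<mu> (\<lambda>t. t ^ k)" for k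
      by (intro integrable_continuous_compact_support[OF \<mu>(1,2) _ \<mu>(3)] continuous_intros) auto
    have int2: "integrable \<mu> (\<lambda>t. t ^ n * g t)"
    proof (rule Bochner_Integration.integrable_bound[OF g_int])
      show "AE t in \<mu>. norm (t ^ n * g t) \<le> norm (g t)"
        using AE1 by eventually_elim (auto simp: abs_mult g0 power_le_one intro!: mult_left_le_one_le)
    qed measurable
    have "\<gamma> n = \<gamma> 0 + (\<Sum>k<n. \<gamma> (Suc k) - \<gamma> k)" by (simp add: sum_lessThan_telescope)
    also have "\<dots> = \<gamma> 0 + c * (\<integral>t. (\<Sum>k<n. t ^ k) \<partial>\<mu>)"
      by (simp add: mom int sum_distrib_left)
    \<comment> \<open>The finite geometric sum is (1 - t^n) / (1 - t), valid because t < 1 almost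
      everywhere.\<close>
    also have "(\<integral>t. (\<Sum>k<n. t ^ k) \<partial>\<mu>) = (\<integral>t. g t - t ^ n * g t \<partial>\<mu>)"
    proof (rule integral_cong_AE)
      show "AE t in \<mu>. (\<Sum>k<n. t ^ k) = g t - t ^ n * g t"
        using AE1
      proof eventually_elim
        fix t :: real assume t: "0 \<le> t \<and> t < 1"
        then show "(\<Sum>k<n. t ^ k) = g t - t ^ n * g t"
          by (subst sum_gp_strict) (auto simp: g_def diff_divide_distrib)
      qed
    qed measurable
    also have "\<dots> = (\<integral>t. g t \<partial>\<mu>) - (\<integral>t. t ^ n * g t \<partial>\<mu>)"
      by (rule Bochner_Integration.integral_diff[OF g_int int2])
    finally have "\<gamma> n = m - c * (\<integral>t. t ^ n * g t \<partial>\<mu>)" by (simp add: m_def algebra_simps)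
    moreover have "(\<integral>t. t ^ n \<partial>P) = m"
      using m0 by (simp add: P_def integral_density integral_return)
    moreover have "(\<integral>t. t ^ n \<partial>N) = c * (\<integral>t. t ^ n * g t \<partial>\<mu>)"
      using c g0 by (simp add: N_def integral_density mult.assoc mult.commute[of "g _"])
    moreover have "signed_integral \<eta> (\<lambda>t. t ^ n) = (\<integral>t. t ^ n \<partial>P) - (\<integral>t. t ^ n \<partial>N)"
      unfolding \<eta>_def
    \<comment> \<open>\<open>P\<close> is concentrated at 1 and \<open>N\<close> has no mass there,
      so the point 1 separates them and they are the two variations.\<close>
    proof (rule signed_integral_diff[OF P _ N, where D = "{1}"])
      show "emeasure P (- {1}) = 0" using P_emeasure[of "- {1}"] by simp
      show "emeasure N {1} = 0" by (rule N_null) auto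
    qed simp_all
    ultimately show ?thesis by simp
  qed
  ultimately have "berger_charge \<gamma> \<eta>"
    unfolding berger_charge_def by (auto intro!: exI[of _ "{0..1}"])
  then show ?thesis by blast
qed

theorem theorem2p2:
  fixes \<alpha> \<beta> \<gamma> :: "nat \<Rightarrow> real" and c :: real and \<mu> :: "real measure"
  assumes "weight_sequence \<alpha>"
    and "\<gamma> = moments \<alpha>"
    and "completely_hyperexpansive \<alpha>"
    and "c = \<gamma> 1 - \<gamma> 0"
    and "c > 0"
    and "weight_sequence \<beta>"
    and "\<forall>n. moments \<beta> n = fdiff \<gamma> n / c"
    and "berger_measure (moments \<beta>) \<mu>"
    and "contractive (weighted_shift \<beta>)"
  shows "(\<exists>\<eta>. berger_charge \<gamma> \<eta>) \<longleftrightarrow>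
    (\<integral>\<^sup>+x\<in>{0..1}. 1 / ennreal (1 - x) \<partial>\<mu>) < \<infinity>"
proof -
  obtain K where prob: "prob_space \<mu>" and sets: "sets \<mu> = sets borel"
    and K: "compact K" "K \<subseteq> {0..}" "emeasure \<mu> (- K) = 0"
    and \<beta>: "\<And>n. moments \<beta> n = (\<integral>t. t ^ n \<partial>\<mu>)"
    using assms(8) unfolding berger_measure_def by auto
  interpret \<mu>: prob_space \<mu> by fact
  have fin: "finite_measure \<mu>" by unfold_locales
  have "AE t in \<mu>. t \<in> K"
    by (rule AE_I[of _ _ "- K"]) (use K sets borel_compact[OF K(1)] in auto)
  \<comment> \<open>Contractivity enters only here: weights in [0, 1] bound all moments by 1, which
    confines \<open>\<mu>\<close> to the unit interval.\<close>
  moreover have "moments \<beta> n \<le> 1" for n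
    unfolding moments_def
    using assms(6) contractive_weight_le_1[OF assms(6,9)]
    by (intro prod_le_1) (auto simp: weight_sequence_def power_le_one)
  ultimately have supp: "AE t in \<mu>. t \<in> {0..1}"
    using K by (intro bounded_moments_support[OF fin sets, where K = K and b = 1]) (auto simp: \<beta>)
  have mom: "\<gamma> (Suc n) - \<gamma> n = c * (\<integral>t. t ^ n \<partial>\<mu>)" for n
    using assms(5,7) by (simp add: \<beta>[symmetric] fdiff_def)
  have "\<gamma> 0 \<ge> 0" using assms(2) by (simp add: moments_def)
  then show ?thesis
    using berger_charge_imp_finite[OF fin sets supp assms(5) mom]
      finite_imp_berger_charge[OF fin sets supp assms(5) _ mom] by blast
qed

end
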